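(* Let $\Sigma$ be a finite non-empty alphabet and let $k,\ell\in\mathbb N$. Then $\overset{J}{\sim}_{k,\ell}$ is an equivalence relation on $\Sigma^*$ of finite index (i.e. with finitely many equivalence classes).
   Context: $\mathbb N=\{1,2,\dots\}$, $\mathbb N_0=\mathbb N\cup\{0\}$. For a word $w\in\Sigma^*$, $|w|$ is its length, $|w|_a$ the number of occurrences of the letter $a$ in $w$, and $p(w)=(|w|_a)_{a\in\Sigma}$ its Parikh vector; $p(u)\le p(w)$ is meant componentwise. $\mathrm{ScatFact}(w)$ is the set of (not necessarily contiguous) subsequences of $w$. For $S\subseteq\Sigma^*$, $S_k=S\cap\Sigma^k$ and $S_{\le k}=\bigcup_{i=0}^k S_i$. For $\ell\in\mathbb N_0$, $\mathrm{JScatFact}(w,\ell)$ is the set of words $u\in\Sigma^*$ with $0\le\ell\le|u|-1$ (with only $\ell=0$ allowed if $u$ is empty), $p(u)\le p(w)$, and such that there is $v\in\mathrm{ScatFact}_{|u|-\ell}(u)$ with $v\in\mathrm{ScatFact}(w)$. For $v,w\in\Sigma^*$, $v\overset{J}{\sim}_{k,\ell}w$ means $\mathrm{JScatFact}_{\le k}(v,\ell)=\mathrm{JScatFact}_{\le k}(w,\ell)$. *)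

theory Defs
  imports Main "HOL-Library.Sublist"
begin

definition length_slice :: "'a list set \<Rightarrow> nat \<Rightarrow> 'a list set" where
  "length_slice S k = {w \<in> S. length w = k}"

definition length_upto :: "'a list set \<Rightarrow> nat \<Rightarrow> 'a list set" where
  "length_upto S k = (\<Union>i\<in>{0..k}. length_slice S i)"

definition ScatFact :: "'a list \<Rightarrow> 'a list set" where
  "ScatFact w = {u. subseq u w}"

definition parikh_le :: "'a set \<Rightarrow> 'a list \<Rightarrow> 'a list \<Rightarrow> bool" where
  "parikh_le \<Sigma> u w \<longleftrightarrow> (\<forall>a\<in>\<Sigma>. count_list u a \<le> count_list w a)"

text \<open>
  The empty word is treated separately because subtraction on natural numbers truncates;
  for nonempty \<open>u\<close> the condition on \<open>l\<close> ensures that \<open>length u - l\<close> is an exact difference.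
\<close>

definition JScatFact :: "'a set \<Rightarrow> 'a list \<Rightarrow> nat \<Rightarrow> 'a list set" where
  "JScatFact \<Sigma> w l = {u \<in> lists \<Sigma>.
     (if u = [] then l = 0 else l \<le> length u - 1) \<and>
     parikh_le \<Sigma> u w \<and>
     (\<exists>v \<in> length_slice (ScatFact u) (length u - l). v \<in> ScatFact w)}"

definition jsim :: "'a set \<Rightarrow> nat \<Rightarrow> nat \<Rightarrow> ('a list \<times> 'a list) set" where
  "jsim \<Sigma> k l = {(v, w). v \<in> lists \<Sigma> \<and> w \<in> lists \<Sigma> \<and>
     length_upto (JScatFact \<Sigma> v l) k = length_upto (JScatFact \<Sigma> w l) k}"

end

theory Submission
  imports Defs
begin

text \<open>The relation \<open>jsim \<Sigma> k l\<close> is the kernel, on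
  \<open>lists \<Sigma>\<close>, of the map f sending w to
  \<open>length_upto (JScatFact \<Sigma> w l) k\<close>; a kernel is always an equivalence. Its
  index is the number of values of f. Every value is a set of words of length at most k over the
  finite alphabet, and there are only finitely many such sets.\<close>

lemma equiv_kernel_on: "equiv A {(x, y). x \<in> A \<and> y \<in> A \<and> f x = f y}"
  by (rule equivI) (auto simp: refl_on_def sym_def trans_def)

text \<open>The class of x is the fibre of f over \<open>f x\<close>, so mapping each value to its
  fibre in A covers the whole quotient.\<close>

lemma finite_quotient_kernel_on:
  assumes "finite (f ` A)"
  shows "finite (A // {(x, y). x \<in> A \<and> y \<in> A \<and> f x = f y})"
proof (rule finite_subset)
  show "A // {(x, y). x \<in> A \<and> y \<in> A \<and> f x = f y} \<subseteq> (\<lambda>c. {y \<in> A. f y = c}) ` f ` A"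
  proof
    fix C assume "C \<in> A // {(x, y). x \<in> A \<and> y \<in> A \<and> f x = f y}"
    then obtain x where "x \<in> A" and "C = {(x, y). x \<in> A \<and> y \<in> A \<and> f x = f y} `` {x}"
      by (rule quotientE)
    then have "C = {y \<in> A. f y = f x}"
      by auto
    with \<open>x \<in> A\<close> show "C \<in> (\<lambda>c. {y \<in> A. f y = c}) ` f ` A"
      by blast
  qed
  show "finite ((\<lambda>c. {y \<in> A. f y = c}) ` f ` A)"
    using assms by (rule finite_imageI)
qed

text \<open>The point is that the bound is independent of w and l: one set of words serves for all
  values of f.\<close>

lemma length_upto_JScatFact_subset:
  "length_upto (JScatFact \<Sigma> w l) k \<subseteq> {u. set u \<subseteq> \<Sigma> \<and> length u \<le> k}"
  by (auto simp: length_upto_def length_slice_def JScatFact_def)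

theorem lemma23:
  fixes \<Sigma> :: "'a set" and k l :: nat
  assumes "finite \<Sigma>" and "\<Sigma> \<noteq> {}" and "1 \<le> k" and "1 \<le> l"
  shows "equiv (lists \<Sigma>) (jsim \<Sigma> k l) \<and> finite (lists \<Sigma> // jsim \<Sigma> k l)"
proof
  show "equiv (lists \<Sigma>) (jsim \<Sigma> k l)"
    unfolding jsim_def by (rule equiv_kernel_on)
  \<comment> \<open>This power set is a finite codomain for f; the finiteness of
    \<open>\<Sigma>\<close> enters here.\<close>
  have "finite (Pow {u. set u \<subseteq> \<Sigma> \<and> length u \<le> k})"
    using finite_lists_length_le[OF \<open>finite \<Sigma>\<close>] by simp
  then have "finite ((\<lambda>w. length_upto (JScatFact \<Sigma> w l) k) ` lists \<Sigma>)"
    by (rule finite_subset[rotated]) (use length_upto_JScatFact_subset in blast)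
  then show "finite (lists \<Sigma> // jsim \<Sigma> k l)"
    unfolding jsim_def by (rule finite_quotient_kernel_on)
qed

end
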